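(* Let $n \geq 2$ be an integer and $q = 2^n$. Then $|\mathrm{Solv}(\mathrm{PSL}(2, q))| = 2q^2$.
   Context: For a finite group $G$ and $x \in G$, the solvabilizer of $x$ in $G$ is $\mathrm{Sol}_G(x) = \{y \in G : \langle x, y \rangle \text{ is solvable}\}$. $\mathrm{Solv}(G) = \{\mathrm{Sol}_G(x) : x \in G\}$ is the set of distinct solvabilizers of elements of $G$, and $|\mathrm{Solv}(G)|$ is its cardinality. *)

theory Defs
  imports "HOL-Algebra.Algebra"
begin

text \<open>2x2 matrices over a field, represented as quadruples (a,b,c,d) standing for
  the matrix with rows (a b) and (c d).\<close>

type_synonym 'a mat2 = "'a \<times> 'a \<times> 'a \<times> 'a"

definition mat2_mult :: "'a::field mat2 \<Rightarrow> 'a mat2 \<Rightarrow> 'a mat2" where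
  "mat2_mult A B = (case A of (a1, a2, a3, a4) \<Rightarrow> (case B of (b1, b2, b3, b4) \<Rightarrow>
      (a1*b1 + a2*b3, a1*b2 + a2*b4, a3*b1 + a4*b3, a3*b2 + a4*b4)))"

definition mat2_det :: "'a::field mat2 \<Rightarrow> 'a" where
  "mat2_det A = (case A of (a1, a2, a3, a4) \<Rightarrow> a1*a4 - a2*a3)"

definition mat2_id :: "'a::field mat2" where
  "mat2_id = (1, 0, 0, 1)"

definition SL2 :: "('a::field mat2) monoid" where
  "SL2 = \<lparr> carrier = {A. mat2_det A = 1}, monoid.mult = mat2_mult, one = mat2_id \<rparr>"

text \<open>Its centre: the scalar matrices of determinant 1.\<close>
definition SL2_scalars :: "('a::field mat2) set" where
  "SL2_scalars = {(c, 0, 0, c) | c. c * c = 1}"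

definition PSL2 :: "('a::field mat2 set) monoid" where
  "PSL2 = SL2 Mod SL2_scalars"

definition Sol :: "('g, 'b) monoid_scheme \<Rightarrow> 'g \<Rightarrow> 'g set" where
  "Sol G x = {y \<in> carrier G. solvable (G\<lparr>carrier := generate G {x, y}\<rparr>)}"

definition Solv :: "('g, 'b) monoid_scheme \<Rightarrow> 'g set set" where
  "Solv G = {Sol G x | x. x \<in> carrier G}"

end

theory Submission
  imports Defs
begin

text \<open>In characteristic 2 the group PSL(2,q) is SL(2,q). With X, Y, Z the traces of x, y and xy,
  the subgroup generated by x and y is solvable iff X^2 + Y^2 + Z^2 = XYZ or two of X, Y, Z vanish.
  The first condition says that the commutator of x and y has trace 2, i.e. that x and y have a
  common eigenvector over the algebraic closure; in the second case, two of x, y, xy are involutions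
  and the group is dihedral. Necessity follows by taking an element a \<noteq> 1 of the last nontrivial
  derived subgroup: every conjugate of a commutes with a, so that x and y either fix the line fixed
  by a or normalize the torus through a.

  By this criterion the solvabilizer of an element of trace 0 (the identity or an involution)
  determines the element, and that of any other element depends only on its torus, the subalgebra
  it generates. Such a subalgebra contains exactly one coset modulo the scalars of matrices of
  trace 1, so tori are parametrized by two off-diagonal entries; elements of trace 0 are as well,
  because square roots are unique. This gives q^2 + q^2 solvabilizers.\<close>

section \<open>Solvable subgroups\<close>

lemma (in group) exp_of_derived_consistent:
  assumes "subgroup K G"
  shows "(derived (G\<lparr>carrier := K\<rparr>) ^^ n) K = (derived G ^^ n) K"
proof (induction n)
  case (Suc n)
  have "(derived G ^^ n) K \<subseteq> K"
    using mono_derived[of _ K] derived_incl[OF _ assms] by (induction n) auto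
  then show ?case using Suc derived_consistent[OF _ assms] by simp
qed simp

text \<open>The derived series of a subgroup is the same whether formed inside it or in the ambient
  group, so solvability of generated subgroups becomes a question about subsets of
  \<open>G\<close>.\<close>

lemma (in group) solvable_restrict_iff:
  assumes "subgroup K G"
  shows "solvable (G\<lparr>carrier := K\<rparr>) \<longleftrightarrow> (\<exists>n. (derived G ^^ n) K = {\<one>})"
  using group.solvable_iff_trivial_derived_seq[OF subgroup_imp_group[OF assms]]
  by (simp add: exp_of_derived_consistent[OF assms])

lemma (in group) derived_commuting:
  assumes "A \<subseteq> carrier G" "\<And>a b. a \<in> A \<Longrightarrow> b \<in> A \<Longrightarrow> a \<otimes> b = b \<otimes> a"
  shows "derived G A \<subseteq> {\<one>}"
proof -
  have "derived_set G A \<subseteq> {\<one>}"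
  proof clarify
    fix a b assume ab: "a \<in> A" "b \<in> A"
    then have c: "a \<in> carrier G" "b \<in> carrier G" using assms(1) by auto
    have "a \<otimes> b \<otimes> inv a \<otimes> inv b = b \<otimes> a \<otimes> inv a \<otimes> inv b" using assms(2) ab by simp
    also have "\<dots> = \<one>" using c by (simp add: m_assoc)
    finally show "a \<otimes> b \<otimes> inv a \<otimes> inv b = \<one>" .
  qed
  then show ?thesis
    unfolding derived_def using generate_subgroup_incl triv_subgroup by blast
qed

text \<open>Commutators of \<open>generate G S\<close> fall into the abelian \<open>A\<close>, so
  its second derived subgroup is trivial. The generated subgroup never has to be described: it only
  has to lie in a convenient overgroup \<open>K\<close>.\<close>

lemma (in group) metabelian_solvable:
  assumes K: "subgroup K G" and SK: "S \<subseteq> K" and A: "subgroup A G"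
    and comm: "\<And>a b. a \<in> A \<Longrightarrow> b \<in> A \<Longrightarrow> a \<otimes> b = b \<otimes> a"
    and der: "\<And>x y. x \<in> K \<Longrightarrow> y \<in> K \<Longrightarrow> x \<otimes> y \<otimes> inv x \<otimes> inv y \<in> A"
  shows "solvable (G\<lparr>carrier := generate G S\<rparr>)"
proof -
  have S: "S \<subseteq> carrier G" using SK subgroup.subset[OF K] by blast
  have gS: "subgroup (generate G S) G" using generate_is_subgroup[OF S] .
  have "generate G S \<subseteq> K" using generate_subgroup_incl[OF SK K] .
  then have "derived_set G (generate G S) \<subseteq> A" using der by blast
  then have "derived G (generate G S) \<subseteq> A"
    unfolding derived_def using generate_subgroup_incl A by blast
  moreover have "derived G A \<subseteq> {\<one>}"
    using derived_commuting comm subgroup.subset[OF A] by blast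
  ultimately have "(derived G ^^ 2) (generate G S) \<subseteq> {\<one>}"
    using mono_derived[of "derived G (generate G S)" A] by (auto simp: numeral_2_eq_2)
  moreover have "\<one> \<in> (derived G ^^ 2) (generate G S)"
    using exp_of_derived_is_subgroup[OF gS] by (rule subgroup.one_closed)
  ultimately show ?thesis using solvable_restrict_iff[OF gS] by blast
qed

text \<open>Take \<open>a\<close> in the last nontrivial term of the derived series of
  \<open>K\<close>. That term is abelian, as its derived subgroup is trivial, and normal in
  \<open>K\<close>, so it contains all conjugates of \<open>a\<close>.\<close>

lemma (in group) solvable_imp_commuting_conjugates:
  assumes K: "subgroup K G" and "solvable (G\<lparr>carrier := K\<rparr>)" and "K \<noteq> {\<one>}"
  obtains a where "a \<in> K" "a \<noteq> \<one>"
    "\<And>x. x \<in> K \<Longrightarrow> a \<otimes> (x \<otimes> a \<otimes> inv x) = (x \<otimes> a \<otimes> inv x) \<otimes> a"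
proof -
  define N where "N = (LEAST n. (derived G ^^ n) K = {\<one>})"
  have ex: "\<exists>n. (derived G ^^ n) K = {\<one>}" using assms solvable_restrict_iff by blast
  have N: "(derived G ^^ N) K = {\<one>}" unfolding N_def using ex by (rule LeastI_ex)
  have "N \<noteq> 0"
  proof
    assume "N = 0" with N \<open>K \<noteq> {\<one>}\<close> show False by simp
  qed
  then obtain m where m: "N = Suc m" by (cases N) auto
  define A where "A = (derived G ^^ m) K"
  have A: "subgroup A G" unfolding A_def using exp_of_derived_is_subgroup[OF K] .
  have "A \<noteq> {\<one>}" using not_less_Least[of m "\<lambda>n. (derived G ^^ n) K = {\<one>}"] m
    unfolding A_def N_def by auto
  then obtain a where a: "a \<in> A" "a \<noteq> \<one>" using subgroup.one_closed[OF A] by blast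
  have dA: "derived G A = {\<one>}" using N m unfolding A_def by simp
  interpret K: group "G\<lparr>carrier := K\<rparr>" using subgroup_imp_group[OF K] .
  \<comment> \<open>Normality is proved inside the restricted group, where the derived subgroup of a
    normal subgroup is again normal; the result carries over because the two series agree.\<close>
  have "(derived (G\<lparr>carrier := K\<rparr>) ^^ m) K \<lhd> G\<lparr>carrier := K\<rparr>"
  proof (induction m)
    case 0 then show ?case using K.normal_self by simp
  next
    case (Suc m) then show ?case using K.derived_is_normal by simp
  qed
  then have normal: "A \<lhd> G\<lparr>carrier := K\<rparr>"
    unfolding A_def exp_of_derived_consistent[OF K] .
  have AK: "A \<subseteq> K" using normal_imp_subgroup[OF normal] subgroup.subset by fastforce
  have comm: "b \<otimes> c = c \<otimes> b" if "b \<in> A" "c \<in> A" for b c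
  proof -
    have bc: "b \<in> carrier G" "c \<in> carrier G" using that subgroup.subset[OF A] by auto
    have "b \<otimes> c \<otimes> inv b \<otimes> inv c \<in> derived G A"
      unfolding derived_def using that by (intro generate.incl) blast
    then have "b \<otimes> c \<otimes> inv b \<otimes> inv c = \<one>" using dA by simp
    then have "b \<otimes> c \<otimes> inv b = c" using bc by (metis inv_equality inv_inv m_closed inv_closed)
    then show ?thesis using bc by (metis inv_solve_right m_closed)
  qed
  show thesis
  proof (rule that[of a])
    show "a \<in> K" "a \<noteq> \<one>" using a AK by auto
    fix x assume "x \<in> K"
    then have "x \<otimes> a \<otimes> inv x \<in> A"
      using normal.inv_op_closed2[OF normal, of x a] a m_inv_consistent[OF K] by simp
    then show "a \<otimes> (x \<otimes> a \<otimes> inv x) = (x \<otimes> a \<otimes> inv x) \<otimes> a" using comm a by blast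
  qed
qed

text \<open>The group is dihedral: \<open>A\<close> consists of the rotations, the powers of
  \<open>r\<close>, and \<open>K\<close> adds the reflections \<open>g \<otimes> a\<close>.
  Conjugation by \<open>a\<close> inverts rotations, hence every commutator in \<open>K\<close> is a
  rotation.\<close>

lemma (in group) generate_involutions_solvable:
  assumes a: "a \<in> carrier G" and b: "b \<in> carrier G" and aa: "a \<otimes> a = \<one>" and bb: "b \<otimes> b = \<one>"
  shows "solvable (G\<lparr>carrier := generate G {a, b}\<rparr>)"
proof -
  define r where "r = a \<otimes> b"
  have r: "r \<in> carrier G" unfolding r_def using a b by simp
  define A where "A = range (\<lambda>i::int. r [^] i)"
  define K where "K = A \<union> (\<lambda>g. g \<otimes> a) ` A"
  have inva: "inv a = a" and invb: "inv b = b" using a b aa bb inv_equality by auto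
  have Ac: "A \<subseteq> carrier G" unfolding A_def using r by auto
  have A: "subgroup A G"
  proof
    show "\<one> \<in> A" unfolding A_def by (rule range_eqI[of _ _ 0]) simp
    show "x \<otimes> y \<in> A" if "x \<in> A" "y \<in> A" for x y
      using that r unfolding A_def by (auto simp: int_pow_mult[symmetric])
    show "inv x \<in> A" if "x \<in> A" for x
      using that r unfolding A_def by (auto simp: int_pow_neg[symmetric])
  qed (use Ac in auto)
  have comm: "x \<otimes> y = y \<otimes> x" if "x \<in> A" "y \<in> A" for x y
    using that r unfolding A_def by (auto simp: int_pow_mult[symmetric] add.commute)
  have ara: "a \<otimes> r \<otimes> a = inv r"
    unfolding r_def using a b aa by (simp add: inv_mult_group inva invb m_assoc[symmetric])
  \<comment> \<open>Inversion by \<open>a\<close> is shown for natural exponents first;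
    \<open>aga\<close> extends it to negative ones by taking inverses.\<close>
  have natp: "a \<otimes> r [^] (n::nat) \<otimes> a = inv (r [^] n)" for n
  proof (induction n)
    case (Suc n)
    have "a \<otimes> r [^] Suc n \<otimes> a = (a \<otimes> r [^] n \<otimes> a) \<otimes> (a \<otimes> r \<otimes> a)"
      using a r aa by (simp add: m_assoc) (metis a aa l_one m_assoc m_closed)
    also have "\<dots> = inv (r [^] n) \<otimes> inv r" using Suc ara by simp
    also have "\<dots> = inv (r \<otimes> r [^] n)" using r by (simp add: inv_mult_group)
    finally show ?case using r by (simp add: nat_pow_Suc2[symmetric])
  qed (use a aa in simp)
  have aga: "a \<otimes> g \<otimes> a = inv g" if gA: "g \<in> A" for g
  proof -
    obtain i :: int where i: "g = r [^] i" using gA unfolding A_def by auto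
    show ?thesis
    proof (cases i)
      case (nonneg n) then show ?thesis using i natp by (simp add: int_pow_int)
    next
      case (neg n)
      then have g: "g = inv (r [^] Suc n)" using i r by (simp add: int_pow_neg int_pow_int del: of_nat_Suc)
      have "a \<otimes> g \<otimes> a = inv (a \<otimes> r [^] Suc n \<otimes> a)"
        unfolding g using a r by (simp add: inv_mult_group inva m_assoc del: nat_pow_Suc)
      then show ?thesis unfolding natp g by simp
    qed
  qed
  have ag: "a \<otimes> g = inv g \<otimes> a" if "g \<in> A" for g
  proof -
    have "g \<in> carrier G" using that Ac by auto
    then show ?thesis using aga[OF that] a aa by (metis m_assoc m_closed r_one)
  qed
  note [simp] = m_assoc
  have Amul: "x \<otimes> y \<in> A" if "x \<in> A" "y \<in> A" for x y
    using A that by (rule subgroup.m_closed)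
  have Ainv: "inv x \<in> A" if "x \<in> A" for x
    using A that by (rule subgroup.m_inv_closed)
  have inv_refl: "inv (g \<otimes> a) = g \<otimes> a" if "g \<in> A" for g
  proof -
    have "g \<in> carrier G" using that Ac by auto
    then show ?thesis using ag[of "inv g"] that a Ainv by (simp add: inv_mult_group inva)
  qed
  have mul_refl: "(g \<otimes> a) \<otimes> (h \<otimes> a) = g \<otimes> inv h" if "g \<in> A" "h \<in> A" for g h
  proof -
    have c: "g \<in> carrier G" "h \<in> carrier G" using that Ac by auto
    have "(g \<otimes> a) \<otimes> (h \<otimes> a) = g \<otimes> (a \<otimes> h \<otimes> a)" using c a by simp
    then show ?thesis using aga that by simp
  qed
  have mul_refl': "(g \<otimes> a) \<otimes> h = (g \<otimes> inv h) \<otimes> a" if "g \<in> A" "h \<in> A" for g h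
  proof -
    have c: "g \<in> carrier G" "h \<in> carrier G" using that Ac by auto
    then show ?thesis using ag that a by simp
  qed
  have K: "subgroup K G"
  proof
    show "K \<subseteq> carrier G" unfolding K_def using Ac a by auto
    show "\<one> \<in> K" unfolding K_def using subgroup.one_closed[OF A] by simp
    show "inv x \<in> K" if "x \<in> K" for x
      using that Ainv inv_refl unfolding K_def by auto
    fix x y assume xy: "x \<in> K" "y \<in> K"
    then consider "x \<in> A" "y \<in> A" | g where "x \<in> A" "g \<in> A" "y = g \<otimes> a"
      | g where "g \<in> A" "x = g \<otimes> a" "y \<in> A" | g h where "g \<in> A" "x = g \<otimes> a" "h \<in> A" "y = h \<otimes> a"
      unfolding K_def by auto
    then show "x \<otimes> y \<in> K"
    proof cases
      case 1 then show ?thesis using Amul unfolding K_def by auto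
    next
      case (2 g)
      then have "x \<otimes> y = (x \<otimes> g) \<otimes> a" using Ac a by (simp add: subset_iff)
      then show ?thesis using Amul 2 unfolding K_def by blast
    next
      case (3 g) then show ?thesis using Amul Ainv mul_refl' unfolding K_def by blast
    next
      case (4 g h) then show ?thesis using Amul Ainv mul_refl unfolding K_def by auto
    qed
  qed
  show ?thesis
  proof (rule metabelian_solvable[OF K _ A comm])
    have "b = inv r \<otimes> a" unfolding r_def using a b aa by (simp add: inv_mult_group inva invb)
    moreover have "r \<in> A" unfolding A_def using r by (intro range_eqI[of _ _ 1]) simp
    then have "inv r \<in> A" using Amul Ainv by simp
    moreover have "a = \<one> \<otimes> a" using a by simp
    moreover have "\<one> \<in> A" using subgroup.one_closed[OF A] .
    ultimately have "a \<in> (\<lambda>g. g \<otimes> a) ` A" "b \<in> (\<lambda>g. g \<otimes> a) ` A" by (blast intro: rev_image_eqI)+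
    then show "{a, b} \<subseteq> K" unfolding K_def by simp
    fix x y assume xy: "x \<in> K" "y \<in> K"
    then consider "x \<in> A" "y \<in> A" | g where "x \<in> A" "g \<in> A" "y = g \<otimes> a"
      | g where "g \<in> A" "x = g \<otimes> a" "y \<in> A" | g h where "g \<in> A" "x = g \<otimes> a" "h \<in> A" "y = h \<otimes> a"
      unfolding K_def by auto
    then show "x \<otimes> y \<otimes> inv x \<otimes> inv y \<in> A"
    proof cases
      case 1 then show ?thesis using Amul Ainv by blast
    next
      case (2 g)
      then have "x \<otimes> y \<otimes> inv x \<otimes> inv y = x \<otimes> (((g \<otimes> a) \<otimes> inv x) \<otimes> (g \<otimes> a))"
        using Ac a inv_refl by (simp add: subset_iff)
      also have "\<dots> = x \<otimes> ((g \<otimes> inv (inv x)) \<otimes> inv g)" 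
        using 2 by (simp only: mul_refl' mul_refl Amul Ainv)
      finally show ?thesis using 2 Amul Ainv by auto
    next
      case (3 g)
      then have "x \<otimes> y \<otimes> inv x \<otimes> inv y = (((g \<otimes> a) \<otimes> y) \<otimes> (g \<otimes> a)) \<otimes> inv y"
        using Ac a inv_refl by (simp add: subset_iff)
      also have "\<dots> = ((g \<otimes> inv y) \<otimes> inv g) \<otimes> inv y" 
        using 3 by (simp only: mul_refl' mul_refl Amul Ainv)
      finally show ?thesis using 3 Amul Ainv by auto
    next
      case (4 g h)
      \<comment> \<open>Reflections are their own inverses, so this commutator is the square of the
        rotation \<open>x \<otimes> y\<close>.\<close>
      then have "x \<otimes> y \<otimes> inv x \<otimes> inv y = ((g \<otimes> a) \<otimes> (h \<otimes> a)) \<otimes> ((g \<otimes> a) \<otimes> (h \<otimes> a))"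
        using Ac a inv_refl by (simp add: subset_iff)
      then show ?thesis using 4 mul_refl Amul Ainv by simp
    qed
  qed
qed

lemma (in group) centralizer_subgroup:
  assumes "S \<subseteq> carrier G"
  shows "subgroup {g \<in> carrier G. \<forall>s\<in>S. g \<otimes> s = s \<otimes> g} G"
proof
  show "x \<otimes> y \<in> {g \<in> carrier G. \<forall>s\<in>S. g \<otimes> s = s \<otimes> g}"
    if "x \<in> {g \<in> carrier G. \<forall>s\<in>S. g \<otimes> s = s \<otimes> g}" "y \<in> {g \<in> carrier G. \<forall>s\<in>S. g \<otimes> s = s \<otimes> g}" for x y
    using that assms by (simp add: m_assoc subset_iff) (simp add: m_assoc[symmetric])
  show "inv x \<in> {g \<in> carrier G. \<forall>s\<in>S. g \<otimes> s = s \<otimes> g}"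
    if "x \<in> {g \<in> carrier G. \<forall>s\<in>S. g \<otimes> s = s \<otimes> g}" for x
  proof -
    have "inv x \<otimes> s = s \<otimes> inv x" if "s \<in> S" for s
    proof -
      have c: "x \<in> carrier G" "s \<in> carrier G" "x \<otimes> s = s \<otimes> x"
        using \<open>s \<in> S\<close> \<open>x \<in> _\<close> assms by auto
      have "inv x \<otimes> s = inv x \<otimes> (s \<otimes> x) \<otimes> inv x" using c(1,2) by (simp add: m_assoc)
      also have "\<dots> = inv x \<otimes> (x \<otimes> s) \<otimes> inv x" using c(3) by simp
      also have "\<dots> = s \<otimes> inv x" using c(1,2) by (simp add: m_assoc[symmetric])
      finally show ?thesis .
    qed
    then show ?thesis using that by simp
  qed
qed (use assms in auto)

text \<open>The double centralizer of a commuting set \<open>S\<close> is an abelian subgroup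
  containing \<open>S\<close>: its elements commute with \<open>C S\<close>, which contains
  \<open>S\<close>, so they lie in \<open>C S\<close> themselves. It serves as both \<open>K\<close>
  and \<open>A\<close>.\<close>

lemma (in group) generate_commuting_solvable:
  assumes S: "S \<subseteq> carrier G" and comm: "\<And>x y. x \<in> S \<Longrightarrow> y \<in> S \<Longrightarrow> x \<otimes> y = y \<otimes> x"
  shows "solvable (G\<lparr>carrier := generate G S\<rparr>)"
proof -
  define C where "C T = {g \<in> carrier G. \<forall>s\<in>T. g \<otimes> s = s \<otimes> g}" for T
  have C: "C T \<subseteq> carrier G" for T unfolding C_def by auto
  have SC: "S \<subseteq> C S" using S comm unfolding C_def by auto
  have CC: "S \<subseteq> C (C S)" using S unfolding C_def by auto
  have sub: "subgroup (C (C S)) G" using centralizer_subgroup[OF C] unfolding C_def .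
  have commCC: "x \<otimes> y = y \<otimes> x" if "x \<in> C (C S)" "y \<in> C (C S)" for x y
  proof -
    have "y \<in> C S" using that(2) SC unfolding C_def by auto
    then show ?thesis using that(1) unfolding C_def by auto
  qed
  show ?thesis
  proof (rule metabelian_solvable[OF sub CC sub commCC])
    fix x y assume "x \<in> C (C S)" "y \<in> C (C S)"
    then show "x \<otimes> y \<otimes> inv x \<otimes> inv y \<in> C (C S)"
      using sub by (intro subgroup.m_closed[OF sub] subgroup.m_inv_closed[OF sub])
  qed
qed

text \<open>Serves the case where \<open>x\<close> and \<open>xy\<close> are the two involutions;
  \<open>generate_mult_left\<close> does the same for \<open>xy\<close> and
  \<open>y\<close>.\<close>

lemma (in group) generate_mult_right:
  assumes "x \<in> carrier G" "y \<in> carrier G"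
  shows "generate G {x, x \<otimes> y} = generate G {x, y}"
proof
  have s: "subgroup (generate G {x, y}) G" "subgroup (generate G {x, x \<otimes> y}) G"
    using assms by (auto intro!: generate_is_subgroup)
  have "x \<otimes> y \<in> generate G {x, y}" by (intro generate.eng generate.incl) auto
  then show "generate G {x, x \<otimes> y} \<subseteq> generate G {x, y}"
    by (intro generate_subgroup_incl[OF _ s(1)]) (auto intro: generate.incl)
  have "inv x \<otimes> (x \<otimes> y) \<in> generate G {x, x \<otimes> y}"
    by (intro generate.eng generate.incl generate.inv) auto
  then have "y \<in> generate G {x, x \<otimes> y}" using assms by (simp add: m_assoc[symmetric])
  then show "generate G {x, y} \<subseteq> generate G {x, x \<otimes> y}"
    by (intro generate_subgroup_incl[OF _ s(2)]) (auto intro: generate.incl)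
qed

lemma (in group) generate_mult_left:
  assumes "x \<in> carrier G" "y \<in> carrier G"
  shows "generate G {x \<otimes> y, y} = generate G {x, y}"
proof
  have s: "subgroup (generate G {x, y}) G" "subgroup (generate G {x \<otimes> y, y}) G"
    using assms by (auto intro!: generate_is_subgroup)
  have "x \<otimes> y \<in> generate G {x, y}" by (intro generate.eng generate.incl) auto
  then show "generate G {x \<otimes> y, y} \<subseteq> generate G {x, y}"
    by (intro generate_subgroup_incl[OF _ s(1)]) (auto intro: generate.incl)
  have "(x \<otimes> y) \<otimes> inv y \<in> generate G {x \<otimes> y, y}"
    by (intro generate.eng generate.incl generate.inv) auto
  then have "x \<in> generate G {x \<otimes> y, y}" using assms by (simp add: m_assoc)
  then show "generate G {x, y} \<subseteq> generate G {x \<otimes> y, y}"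
    by (intro generate_subgroup_incl[OF _ s(2)]) (auto intro: generate.incl)
qed

section \<open>Transport of solvabilizers along isomorphisms, and a counting principle\<close>

lemma Solv_eq_image: "Solv G = Sol G ` carrier G"
  unfolding Solv_def by auto

text \<open>Homomorphisms carry derived series to derived series, and by injectivity a term has
  trivial image only if it is trivial.\<close>

lemma Sol_iso:
  assumes G: "group G" and H: "group H" and h: "h \<in> iso G H" and x: "x \<in> carrier G"
  shows "Sol H (h x) = h ` Sol G x"
proof -
  interpret group_hom G H h
    using G H h by (simp add: group_hom_def group_hom_axioms_def iso_def)
  have bij: "inj_on h (carrier G)" "h ` carrier G = carrier H"
    using h by (auto simp: iso_def bij_betw_def)
  have "solvable (H\<lparr>carrier := generate H {h x, h y}\<rparr>) \<longleftrightarrow> solvable (G\<lparr>carrier := generate G {x, y}\<rparr>)"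
    if y: "y \<in> carrier G" for y
  proof -
    let ?K = "generate G {x, y}"
    have K: "subgroup ?K G" using x y by (intro G.generate_is_subgroup) auto
    have img: "generate H {h x, h y} = h ` ?K" using generate_img[of "{x, y}"] x y by simp
    have "h ` ((derived G ^^ n) ?K) = {\<one>\<^bsub>H\<^esub>} \<longleftrightarrow> (derived G ^^ n) ?K = {\<one>\<^bsub>G\<^esub>}" for n
      using inj_on_image_eq_iff[OF bij(1), of "(derived G ^^ n) ?K" "{\<one>\<^bsub>G\<^esub>}"]
        G.exp_of_derived_in_carrier[OF subgroup.subset[OF K]] by simp
    then show ?thesis
      unfolding img H.solvable_restrict_iff[OF subgroup_img_is_subgroup[OF K]]
        G.solvable_restrict_iff[OF K] exp_of_derived_img[OF subgroup.subset[OF K]] by simp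
  qed
  then show ?thesis unfolding Sol_def bij(2)[symmetric] by auto
qed

lemma card_Solv_iso:
  assumes "group G" "group H" "h \<in> iso G H"
  shows "card (Solv H) = card (Solv G)"
proof -
  have bij: "inj_on h (carrier G)" "h ` carrier G = carrier H"
    using assms(3) by (auto simp: iso_def bij_betw_def)
  have "Solv H = (`) h ` Solv G"
    unfolding Solv_eq_image bij(2)[symmetric] image_image using Sol_iso[OF assms] by (rule image_cong[OF refl])
  moreover have "inj_on ((`) h) (Solv G)"
    using inj_on_image_Pow[OF bij(1)] by (rule inj_on_subset) (auto simp: Solv_def Sol_def)
  ultimately show ?thesis by (simp add: card_image)
qed

text \<open>Sending \<open>f x\<close> to \<open>g x\<close> is a well-defined bijection between the
  images. This lets solvabilizers be counted through an explicit invariant.\<close>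

lemma card_image_eq_if_same_kernel:
  assumes "\<And>x y. x \<in> A \<Longrightarrow> y \<in> A \<Longrightarrow> f x = f y \<longleftrightarrow> g x = g y"
  shows "card (f ` A) = card (g ` A)"
proof -
  let ?r = "\<lambda>v. g (inv_into A f v)"
  have r: "?r (f x) = g x" if "x \<in> A" for x
    using assms[OF inv_into_into[of "f x" f A] that] f_inv_into_f[of "f x" f A] that by auto
  have "g ` A = ?r ` f ` A" unfolding image_image using r by auto
  moreover have "inj_on ?r (f ` A)" by (auto intro!: inj_onI simp: r assms)
  ultimately show ?thesis by (simp add: card_image)
qed

section \<open>A trace criterion for solvability\<close>

definition mat2_tr :: "'a::field mat2 \<Rightarrow> 'a" where
  "mat2_tr A = (case A of (a, b, c, d) \<Rightarrow> a + d)"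

definition mat2_app :: "'a::field mat2 \<Rightarrow> 'a \<times> 'a \<Rightarrow> 'a \<times> 'a" where
  "mat2_app A v = (case A of (a, b, c, d) \<Rightarrow> case v of (s, t) \<Rightarrow> (a * s + b * t, c * s + d * t))"

lemma mat2_mult_simps [simp]:
  "mat2_mult (a, b, c, d) (e, f, g, h) = (a * e + b * g, a * f + b * h, c * e + d * g, c * f + d * h)"
  by (simp add: mat2_mult_def)

lemma mat2_det_simps [simp]: "mat2_det (a, b, c, d) = a * d - b * c"
  by (simp add: mat2_det_def)

lemma mat2_tr_simps [simp]: "mat2_tr (a, b, c, d) = a + d"
  by (simp add: mat2_tr_def)

lemma mat2_app_simps [simp]: "mat2_app (a, b, c, d) (s, t) = (a * s + b * t, c * s + d * t)"
  by (simp add: mat2_app_def)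

lemma mat2_mult_one [simp]: "mat2_mult (1, 0, 0, 1) A = A" "mat2_mult A (1, 0, 0, 1) = A"
  by (cases A; simp)+

lemma mat2_mult_assoc: "mat2_mult (mat2_mult A B) C = mat2_mult A (mat2_mult B C)"
  by (cases A; cases B; cases C) (simp add: algebra_simps)

lemma mat2_det_mult: "mat2_det (mat2_mult A B) = mat2_det A * mat2_det B"
  by (cases A; cases B) (simp add: algebra_simps)

lemma mat2_tr_commute: "mat2_tr (mat2_mult A B) = mat2_tr (mat2_mult B A)"
  by (cases A; cases B) (simp add: algebra_simps)

lemma mat2_app_mult: "mat2_app (mat2_mult A B) v = mat2_app A (mat2_app B v)"
  by (cases A; cases B; cases v) (simp add: algebra_simps)

lemma SL2_simps [simp]:
  "A \<in> carrier SL2 \<longleftrightarrow> mat2_det A = 1"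
  "A \<otimes>\<^bsub>SL2\<^esub> B = mat2_mult A B"
  "\<one>\<^bsub>SL2\<^esub> = (1, 0, 0, 1)"
  by (simp_all add: SL2_def mat2_id_def)

lemma SL2_group: "group SL2"
proof (rule groupI)
  fix A :: "'a mat2" assume "A \<in> carrier SL2"
  then show "\<exists>B\<in>carrier SL2. B \<otimes>\<^bsub>SL2\<^esub> A = \<one>\<^bsub>SL2\<^esub>"
    by (cases A) (rule bexI[of _ "case A of (a, b, c, d) \<Rightarrow> (d, -b, -c, a)"], auto simp: algebra_simps)
next
  fix A :: "'a mat2" assume "A \<in> carrier SL2"
  show "\<one>\<^bsub>SL2\<^esub> \<otimes>\<^bsub>SL2\<^esub> A = A" by (cases A) simp
qed (auto simp: mat2_det_mult mat2_mult_assoc)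

interpretation SL2: group SL2 by (rule SL2_group)

lemma SL2_inv:
  assumes "a * d - b * c = 1"
  shows "inv\<^bsub>SL2\<^esub> (a, b, c, d) = (d, -b, -c, a)"
  using assms by (intro SL2.inv_equality) (auto simp: algebra_simps)

text \<open>Fricke's trace identity.\<close>

lemma mat2_tr_commutator:
  assumes "x \<in> carrier SL2" "y \<in> carrier SL2"
  shows "mat2_tr (x \<otimes>\<^bsub>SL2\<^esub> y \<otimes>\<^bsub>SL2\<^esub> inv\<^bsub>SL2\<^esub> x \<otimes>\<^bsub>SL2\<^esub> inv\<^bsub>SL2\<^esub> y) =
    mat2_tr x ^ 2 + mat2_tr y ^ 2 + mat2_tr (mat2_mult x y) ^ 2
      - mat2_tr x * mat2_tr y * mat2_tr (mat2_mult x y) - 2"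
proof -
  obtain a b c d where x: "x = (a, b, c, d)" by (cases x)
  obtain e f g h where y: "y = (e, f, g, h)" by (cases y)
  have d: "a * d - b * c = 1" "e * h - f * g = 1" using assms x y by auto
  \<comment> \<open>With adjugates for inverses and determinant factors inserted on the right, this
    is a polynomial identity in the eight entries; the determinants are set to 1 afterwards.\<close>
  have "mat2_tr (mat2_mult (mat2_mult (mat2_mult x y) (d, -b, -c, a)) (h, -f, -g, e)) =
    (a + d)^2 * (e * h - f * g) + (e + h)^2 * (a * d - b * c) + mat2_tr (mat2_mult x y) ^ 2
      - (a + d) * (e + h) * mat2_tr (mat2_mult x y) - 2 * (a * d - b * c) * (e * h - f * g)"
    unfolding x y by (simp add: algebra_simps power2_eq_square)
  then show ?thesis using d unfolding x y by (simp add: SL2_inv)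
qed

text \<open>The left-hand side is the determinant of xy - yx, up to sign.\<close>

lemma mat2_det_Lie:
  assumes "a * d - b * c = 1" "e * h - f * g = (1::'a::field)"
  shows "(b * g - c * f)^2 + (a * f + b * h - e * b - f * d) * (c * e + d * g - g * a - h * c) =
    (a + d)^2 + (e + h)^2 + (a * e + b * g + c * f + d * h)^2
      - (a + d) * (e + h) * (a * e + b * g + c * f + d * h) - 4"
proof -
  have "(b * g - c * f)^2 + (a * f + b * h - e * b - f * d) * (c * e + d * g - g * a - h * c) =
    (a + d)^2 * (e * h - f * g) + (e + h)^2 * (a * d - b * c) + (a * e + b * g + c * f + d * h)^2
      - (a + d) * (e + h) * (a * e + b * g + c * f + d * h) - 4 * (a * d - b * c) * (e * h - f * g)"
    by (simp add: algebra_simps power2_eq_square)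
  then show ?thesis using assms by simp
qed

definition solv_traces :: "'a::field \<Rightarrow> 'a \<Rightarrow> 'a \<Rightarrow> bool" where
  "solv_traces x y z \<longleftrightarrow> x ^ 2 + y ^ 2 + z ^ 2 = x * y * z \<or>
    x = 0 \<and> y = 0 \<or> x = 0 \<and> z = 0 \<or> y = 0 \<and> z = 0"

text \<open>The stabilizer \<open>K\<close> of the line through \<open>v\<close> is a Borel
  subgroup. Its commutators fix \<open>v\<close> itself, and the pointwise stabilizer
  \<open>A\<close> is an abelian unipotent group.\<close>

lemma SL2_eigenvector_solvable:
  fixes v :: "'a::field \<times> 'a"
  assumes v: "v \<noteq> (0, 0)" and S: "S \<subseteq> carrier SL2"
    and eig: "\<And>g. g \<in> S \<Longrightarrow> \<exists>l. mat2_app g v = (l * fst v, l * snd v)"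
  shows "solvable (SL2\<lparr>carrier := generate SL2 S\<rparr>)"
proof -
  define K where "K = {g \<in> carrier SL2. \<exists>l. mat2_app g v = (l * fst v, l * snd v)}"
  define A where "A = {g \<in> carrier SL2. mat2_app g v = v}"
  have app_scale: "mat2_app g (l * fst v, l * snd v) = (l * fst (mat2_app g v), l * snd (mat2_app g v))" for g l
    by (cases g; cases v) (simp add: algebra_simps)
  have app_one: "mat2_app (1, 0, 0, 1) w = w" for w :: "'a \<times> 'a" by (cases w) simp
  have app_inv: "mat2_app (inv\<^bsub>SL2\<^esub> g) (mat2_app g w) = w" if "g \<in> carrier SL2" for g and w :: "'a \<times> 'a"
    using SL2.l_inv[OF that] by (simp add: mat2_app_mult[symmetric] app_one)
  have Kinv: "l \<noteq> 0 \<and> mat2_app (inv\<^bsub>SL2\<^esub> g) v = (inverse l * fst v, inverse l * snd v)"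
    if g: "g \<in> carrier SL2" "mat2_app g v = (l * fst v, l * snd v)" for g l
  proof -
    have e: "v = (l * fst (mat2_app (inv\<^bsub>SL2\<^esub> g) v), l * snd (mat2_app (inv\<^bsub>SL2\<^esub> g) v))"
      using app_inv[OF g(1), of v] g(2) app_scale by simp
    have "l \<noteq> 0" using e v by auto
    then show ?thesis using e by (smt (verit) fst_conv snd_conv prod.collapse mult.assoc mult_1 left_inverse)
  qed
  have K: "subgroup K SL2"
  proof
    show "K \<subseteq> carrier SL2" unfolding K_def by auto
    show "\<one>\<^bsub>SL2\<^esub> \<in> K" unfolding K_def by (auto simp: app_one intro!: exI[of _ 1])
    show "inv\<^bsub>SL2\<^esub> x \<in> K" if "x \<in> K" for x
      using that Kinv SL2.inv_closed unfolding K_def by blast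
    fix x y assume "x \<in> K" "y \<in> K"
    then obtain l m where "x \<in> carrier SL2" "mat2_app x v = (l * fst v, l * snd v)"
      "y \<in> carrier SL2" "mat2_app y v = (m * fst v, m * snd v)" unfolding K_def by auto
    then show "x \<otimes>\<^bsub>SL2\<^esub> y \<in> K" unfolding K_def
      by (auto simp: mat2_det_mult mat2_app_mult app_scale intro!: exI[of _ "m * l"])
  qed
  have A: "subgroup A SL2"
  proof
    show "A \<subseteq> carrier SL2" unfolding A_def by auto
    show "\<one>\<^bsub>SL2\<^esub> \<in> A" unfolding A_def by (auto simp: app_one)
    show "inv\<^bsub>SL2\<^esub> x \<in> A" if "x \<in> A" for x
      using that app_inv[of x v] SL2.inv_closed[of x] unfolding A_def by auto
    show "x \<otimes>\<^bsub>SL2\<^esub> y \<in> A" if "x \<in> A" "y \<in> A" for x y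
      using that unfolding A_def by (auto simp: mat2_det_mult mat2_app_mult)
  qed
  obtain s t where st: "v = (s, t)" by (cases v)
  have comm: "mat2_mult x y = mat2_mult y x" if "x \<in> A" "y \<in> A" for x y
  proof (cases "s = 0")
    case True
    then have "\<exists>c. z = (1, 0, c, 1)" if "z \<in> A" for z
      using that v st unfolding A_def by (cases z) auto
    with \<open>x \<in> A\<close> \<open>y \<in> A\<close> obtain c c' where "x = (1, 0, c, 1)" "y = (1, 0, c', 1)" by blast
    then show ?thesis by simp
  next
    case False
    \<comment> \<open>\<open>k\<close> is the slope of \<open>v\<close>. A determinant 1 matrix
      fixing \<open>v\<close> is 1 + bN, where N has rows (-k, 1) and (-k^2, k); matrices of this
      form commute.\<close>
    define k where "k = t / s"
    have "\<exists>b. z = (1 - b * k, b, - b * k * k, 1 + b * k)" if "z \<in> A" for z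
    proof -
      obtain a b c d where z: "z = (a, b, c, d)" by (cases z)
      have e: "a * s + b * t = s" "c * s + d * t = t" "a * d - b * c = 1"
        using that unfolding A_def z st by auto
      have a: "a = 1 - b * k" using e(1) False by (simp add: k_def field_simps)
      have c: "c = (1 - d) * k" using e(2) False by (simp add: k_def field_simps)
      have "d - b * k = 1"
        using e(3) unfolding a c by (simp add: ring_distribs mult.assoc mult.left_commute mult.commute)
      then have d: "d = 1 + b * k" by (simp add: diff_eq_eq)
      show ?thesis unfolding z a c d by (intro exI[of _ b]) simp
    qed
    with \<open>x \<in> A\<close> \<open>y \<in> A\<close> obtain b b' where
      "x = (1 - b * k, b, - b * k * k, 1 + b * k)"
      "y = (1 - b' * k, b', - b' * k * k, 1 + b' * k)" by meson
    then show ?thesis by (simp add: algebra_simps)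
  qed
  show ?thesis
  proof (rule SL2.metabelian_solvable[OF K _ A])
    show "S \<subseteq> K" unfolding K_def using S eig by blast
    show "x \<otimes>\<^bsub>SL2\<^esub> y = y \<otimes>\<^bsub>SL2\<^esub> x" if "x \<in> A" "y \<in> A" for x y
      using comm that by simp
    fix x y assume "x \<in> K" "y \<in> K"
    then obtain l m where x: "x \<in> carrier SL2" "mat2_app x v = (l * fst v, l * snd v)"
      and y: "y \<in> carrier SL2" "mat2_app y v = (m * fst v, m * snd v)" unfolding K_def by auto
    \<comment> \<open>The eigenvalues \<open>l\<close> and \<open>m\<close> cancel against those of
      the inverses.\<close>
    have "mat2_app (x \<otimes>\<^bsub>SL2\<^esub> y \<otimes>\<^bsub>SL2\<^esub> inv\<^bsub>SL2\<^esub> x \<otimes>\<^bsub>SL2\<^esub> inv\<^bsub>SL2\<^esub> y) v = v"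
      using Kinv[OF x] Kinv[OF y] x y
      by (simp add: mat2_app_mult app_scale) (simp add: st field_simps)
    moreover have "x \<otimes>\<^bsub>SL2\<^esub> y \<otimes>\<^bsub>SL2\<^esub> inv\<^bsub>SL2\<^esub> x \<otimes>\<^bsub>SL2\<^esub> inv\<^bsub>SL2\<^esub> y \<in> carrier SL2"
      using x(1) y(1) by (intro SL2.m_closed SL2.inv_closed)
    ultimately show "x \<otimes>\<^bsub>SL2\<^esub> y \<otimes>\<^bsub>SL2\<^esub> inv\<^bsub>SL2\<^esub> x \<otimes>\<^bsub>SL2\<^esub> inv\<^bsub>SL2\<^esub> y \<in> A"
      unfolding A_def by blast
  qed
qed

lemma solv_traces_commute: "solv_traces x y z \<longleftrightarrow> solv_traces y x z"
  unfolding solv_traces_def by (auto simp: ac_simps)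

text \<open>The second case reads off the off-diagonal entries of the trace 1 matrices in the coset of
  A / tr A modulo the scalars.\<close>

definition fingerprint :: "'a::field mat2 \<Rightarrow> bool \<times> 'a \<times> 'a" where
  "fingerprint A = (case A of (a, b, c, d) \<Rightarrow>
     if a + d = 0 then (True, b, c) else (False, b / (a + d), c / (a + d)))"

section \<open>The criterion in characteristic 2\<close>

context
  assumes two: "(1::'a::field) + 1 = 0"
begin

lemma add_self: "(x::'a) + x = 0"
  using two by (metis distrib_left mult_1_right mult_zero_right)

lemma add_self_left: "(x::'a) + (x + y) = y"
  by (simp add: add.assoc[symmetric] add_self)

lemma uminus_self: "- (x::'a) = x"
  using add_self[of x] by (simp add: minus_unique)

lemma diff_self: "(x::'a) - y = x + y"
  by (simp add: diff_conv_add_uminus uminus_self del: add_uminus_conv_diff)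

lemma numeral_two: "(2::'a) = 0" "(4::'a) = 0"
  using two by (metis one_add_one, metis one_add_one numeral_Bit0 add_self)

lemma add_eq_0: "(x::'a) + y = 0 \<longleftrightarrow> x = y"
  by (metis add_self add_left_cancel)

text \<open>A normal form for polynomials modulo 2: products are expanded and sorted, signs
  disappear, and the rules for \<open>x + x\<close> delete monomials occurring twice.\<close>

lemmas char2 = add_self add_self_left uminus_self diff_self numeral_two
  ring_distribs power2_eq_square mult.assoc mult.commute mult.left_commute
  add.assoc add.commute add.left_commute

text \<open>The Frobenius map is additive with trivial kernel.\<close>

lemma square_eq: "(x::'a) ^ 2 = y ^ 2 \<longleftrightarrow> x = y"
proof -
  have "x ^ 2 + y ^ 2 = (x + y) ^ 2" by (simp add: char2)
  then show ?thesis by (metis add_eq_0 power_eq_0_iff zero_power2)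
qed

text \<open>An instance of Cayley-Hamilton: x^2 = tr(x) x - 1, and -1 = 1.\<close>

lemma SL2_involution:
  assumes "x \<in> carrier SL2" "mat2_tr x = (0::'a)"
  shows "x \<otimes>\<^bsub>SL2\<^esub> x = \<one>\<^bsub>SL2\<^esub>"
proof -
  obtain a b c d where x: "x = (a, b, c, d)" by (cases x)
  have "d = a" using assms x by (simp add: add_eq_0)
  then show ?thesis using assms unfolding x by (simp add: char2)
qed

lemma SL2_square_one_tr:
  assumes "x \<otimes>\<^bsub>SL2\<^esub> x = \<one>\<^bsub>SL2\<^esub>"
  shows "mat2_tr x = (0::'a)"
proof -
  obtain a b c d where x: "x = (a, b, c, d)" by (cases x)
  have "a * a + b * c = 1" "c * b + d * d = 1" using assms unfolding x by auto
  then have "a * a + b * c + (c * b + d * d) = 0" using two by simp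
  then have "a ^ 2 = d ^ 2" by (simp add: char2) (simp add: add_eq_0)
  then show ?thesis unfolding x by (simp add: square_eq add_self)
qed

text \<open>If two traces vanish, the group is generated by two elements of square 1. Otherwise
  det(xy - yx) = 0, and either xy - yx is nonzero and supplies an eigenvector over the base field,
  or x and y commute. The latter covers tori that do not split.\<close>

lemma solv_traces_imp_solvable:
  assumes x: "x \<in> carrier SL2" and y: "y \<in> carrier SL2"
    and tr: "solv_traces (mat2_tr x) (mat2_tr y) (mat2_tr (mat2_mult x y) :: 'a)"
  shows "solvable (SL2\<lparr>carrier := generate SL2 {x, y}\<rparr>)"
proof -
  have xy: "mat2_mult x y \<in> carrier SL2" using SL2.m_closed[OF x y] by simp
  consider "mat2_tr x = 0" "mat2_tr y = 0" | "mat2_tr x = 0" "mat2_tr (mat2_mult x y) = 0"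
    | "mat2_tr y = 0" "mat2_tr (mat2_mult x y) = 0"
    | "mat2_tr x ^ 2 + mat2_tr y ^ 2 + mat2_tr (mat2_mult x y) ^ 2
        = mat2_tr x * mat2_tr y * mat2_tr (mat2_mult x y)"
    using tr unfolding solv_traces_def by blast
  then show ?thesis
  proof cases
    case 1 then show ?thesis using SL2.generate_involutions_solvable SL2_involution x y by blast
  next
    case 2 then show ?thesis
      using SL2.generate_involutions_solvable[OF x xy] SL2_involution x xy SL2.generate_mult_right[OF x y] by simp
  next
    case 3 then show ?thesis
      using SL2.generate_involutions_solvable[OF xy y] SL2_involution y xy SL2.generate_mult_left[OF x y] by simp
  next
    case 4
    obtain a b c d where X: "x = (a, b, c, d)" by (cases x)
    obtain e f g h where Y: "y = (e, f, g, h)" by (cases y)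
    have det: "a * d - b * c = 1" "e * h - f * g = 1" using x y X Y by auto
    \<comment> \<open>M = xy - yx has rows (p q) and (r p); being nilpotent and traceless it satisfies MxM = MyM = 0,
      so a nonzero column of M is a common eigenvector of x and y.\<close>
    define p where "p = b * g + c * f"
    define q where "q = a * f + b * h + e * b + f * d"
    define r where "r = c * e + d * g + g * a + h * c"
    have "(b * g - c * f) ^ 2 + (a * f + b * h - e * b - f * d) * (c * e + d * g - g * a - h * c) = 0"
      unfolding mat2_det_Lie[OF det] using 4 unfolding X Y
      by (simp add: diff_self numeral_two add.assoc)
    then have pqr: "p ^ 2 = q * r"
      unfolding p_def q_def r_def by (simp only: diff_self add_eq_0)
    \<comment> \<open>A vanishing 2x2 determinant makes \<open>(u, w)\<close> parallel to the
      nonzero vector \<open>(s, t)\<close>.\<close>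
    have wedge: "\<exists>l. (u, w) = (l * s, l * t)" if "u * t = w * s" "(s, t) \<noteq> (0, 0)" for u w s t :: 'a
    proof (cases "s = 0")
      case True then show ?thesis using that by (intro exI[of _ "w / t"]) auto
    next
      case False then show ?thesis using that by (intro exI[of _ "u / s"]) (auto simp: field_simps)
    qed
    consider "(p, r) \<noteq> (0, 0)" | "(q, p) \<noteq> (0, 0)" | "p = 0" "q = 0" "r = 0" by auto
    then show ?thesis
    proof cases
      case 1
      show ?thesis
      proof (rule SL2_eigenvector_solvable[OF 1])
        \<comment> \<open>For the first column \<open>v\<close> of M, the determinants of the pairs
          xv, v and yv, v are multiples of det M, which is 0. The second column is treated alike
          below.\<close>
        have "(a * p + b * r) * r + (c * p + d * r) * p = c * (p ^ 2 + q * r)"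
          "(e * p + f * r) * r + (g * p + h * r) * p = g * (p ^ 2 + q * r)"
          unfolding p_def q_def r_def by (simp_all add: char2)
        then have "(a * p + b * r) * r = (c * p + d * r) * p" "(e * p + f * r) * r = (g * p + h * r) * p"
          by (simp_all add: pqr add_self add_eq_0)
        then show "\<exists>l. mat2_app k (p, r) = (l * fst (p, r), l * snd (p, r))" if "k \<in> {x, y}" for k
          using wedge[OF _ 1] that unfolding X Y by auto
      qed (use x y in auto)
    next
      case 2
      show ?thesis
      proof (rule SL2_eigenvector_solvable[OF 2])
        have "(a * q + b * p) * p + (c * q + d * p) * q = b * (p ^ 2 + q * r)"
          "(e * q + f * p) * p + (g * q + h * p) * q = f * (p ^ 2 + q * r)"
          unfolding p_def q_def r_def by (simp_all add: char2)
        then have "(a * q + b * p) * p = (c * q + d * p) * q" "(e * q + f * p) * p = (g * q + h * p) * q"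
          by (simp_all add: pqr add_self add_eq_0)
        then show "\<exists>l. mat2_app k (q, p) = (l * fst (q, p), l * snd (q, p))" if "k \<in> {x, y}" for k
          using wedge[OF _ 2] that unfolding X Y by auto
      qed (use x y in auto)
    next
      case 3
      then have "b * g + c * f = 0" "(a * f + b * h) + (e * b + f * d) = 0"
        "(c * e + d * g) + (g * a + h * c) = 0"
        unfolding p_def q_def r_def by (simp_all only: add.assoc)
      then have "b * g = c * f" "a * f + b * h = e * b + f * d" "c * e + d * g = g * a + h * c"
        by (simp_all only: add_eq_0)
      then have "mat2_mult x y = mat2_mult y x" unfolding X Y by (simp add: ac_simps)
      then show ?thesis
        using x y by (intro SL2.generate_commuting_solvable) auto
    qed
  qed
qed

text \<open>The conjugate \<open>e\<close> has square 1 and commutes with \<open>a\<close>, so the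
  commutator of \<open>a\<close> and \<open>w\<close>, which is \<open>ae\<close>, has square 1 and
  hence trace 0. As \<open>a\<close> has trace 0, Fricke's identity leaves a sum of two
  squares.\<close>

lemma mat2_tr_involution_mult:
  assumes a: "a \<in> carrier SL2" "mat2_tr a = (0::'a)" and w: "w \<in> carrier SL2"
    and comm: "a \<otimes>\<^bsub>SL2\<^esub> (w \<otimes>\<^bsub>SL2\<^esub> a \<otimes>\<^bsub>SL2\<^esub> inv\<^bsub>SL2\<^esub> w) = (w \<otimes>\<^bsub>SL2\<^esub> a \<otimes>\<^bsub>SL2\<^esub> inv\<^bsub>SL2\<^esub> w) \<otimes>\<^bsub>SL2\<^esub> a"
  shows "mat2_tr (mat2_mult a w) = mat2_tr w"
proof -
  define e where "e = w \<otimes>\<^bsub>SL2\<^esub> a \<otimes>\<^bsub>SL2\<^esub> inv\<^bsub>SL2\<^esub> w"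
  note aa = SL2_involution[OF a]
  have inva: "inv\<^bsub>SL2\<^esub> a = a" using SL2.inv_equality[OF aa a(1) a(1)] .
  have e: "e \<in> carrier SL2" unfolding e_def using a(1) w by (intro SL2.m_closed SL2.inv_closed)
  have ee: "e \<otimes>\<^bsub>SL2\<^esub> e = \<one>\<^bsub>SL2\<^esub>"
  proof -
    have "e \<otimes>\<^bsub>SL2\<^esub> e = w \<otimes>\<^bsub>SL2\<^esub> (a \<otimes>\<^bsub>SL2\<^esub> ((inv\<^bsub>SL2\<^esub> w \<otimes>\<^bsub>SL2\<^esub> w) \<otimes>\<^bsub>SL2\<^esub> (a \<otimes>\<^bsub>SL2\<^esub> inv\<^bsub>SL2\<^esub> w)))"
      unfolding e_def by (simp add: mat2_mult_assoc)
    also have "\<dots> = w \<otimes>\<^bsub>SL2\<^esub> ((a \<otimes>\<^bsub>SL2\<^esub> a) \<otimes>\<^bsub>SL2\<^esub> inv\<^bsub>SL2\<^esub> w)"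
      using a(1) w SL2.inv_closed[OF w] SL2.l_inv[OF w] SL2.l_one by (simp add: mat2_mult_assoc mat2_det_mult)
    also have "\<dots> = \<one>\<^bsub>SL2\<^esub>"
      using aa SL2.inv_closed[OF w] SL2.r_inv[OF w] SL2.l_one by simp
    finally show ?thesis .
  qed
  have "(a \<otimes>\<^bsub>SL2\<^esub> e) \<otimes>\<^bsub>SL2\<^esub> (a \<otimes>\<^bsub>SL2\<^esub> e) = a \<otimes>\<^bsub>SL2\<^esub> ((e \<otimes>\<^bsub>SL2\<^esub> a) \<otimes>\<^bsub>SL2\<^esub> e)"
    by (simp add: mat2_mult_assoc)
  also have "\<dots> = a \<otimes>\<^bsub>SL2\<^esub> ((a \<otimes>\<^bsub>SL2\<^esub> e) \<otimes>\<^bsub>SL2\<^esub> e)" using comm unfolding e_def by simp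
  also have "\<dots> = (a \<otimes>\<^bsub>SL2\<^esub> a) \<otimes>\<^bsub>SL2\<^esub> (e \<otimes>\<^bsub>SL2\<^esub> e)" by (simp add: mat2_mult_assoc)
  also have "\<dots> = \<one>\<^bsub>SL2\<^esub>" using aa ee by simp
  finally have "mat2_tr (a \<otimes>\<^bsub>SL2\<^esub> e) = 0" by (rule SL2_square_one_tr)
  moreover have "a \<otimes>\<^bsub>SL2\<^esub> w \<otimes>\<^bsub>SL2\<^esub> inv\<^bsub>SL2\<^esub> a \<otimes>\<^bsub>SL2\<^esub> inv\<^bsub>SL2\<^esub> w = a \<otimes>\<^bsub>SL2\<^esub> e"
    unfolding e_def inva by (simp add: mat2_mult_assoc)
  ultimately have "mat2_tr w ^ 2 + mat2_tr (mat2_mult a w) ^ 2 = 0"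
    using mat2_tr_commutator[OF a(1) w] a(2) by (simp add: numeral_two)
  then show ?thesis by (simp add: add_eq_0 square_eq)
qed

text \<open>The matrix a - 1 is nilpotent and nonzero, and tr((a - 1)w) = 0 says exactly that
  \<open>w\<close> preserves its kernel, the line fixed by \<open>a\<close>. So \<open>x\<close> and
  \<open>y\<close> share an eigenvector and det(xy - yx) = 0, which is the cubic trace
  condition.\<close>

lemma common_fixed_line_traces:
  assumes a: "a \<in> carrier SL2" "mat2_tr a = (0::'a)" "a \<noteq> \<one>\<^bsub>SL2\<^esub>"
    and x: "x \<in> carrier SL2" "mat2_tr (mat2_mult a x) = mat2_tr x"
    and y: "y \<in> carrier SL2" "mat2_tr (mat2_mult a y) = mat2_tr y"
  shows "solv_traces (mat2_tr x) (mat2_tr y) (mat2_tr (mat2_mult x y))"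
proof -
  obtain p q r p' where A: "a = (p, q, r, p')" by (cases a)
  have p': "p' = p" using a(2) unfolding A by (simp add: add_eq_0)
  \<comment> \<open>The matrix a - 1 has rows (m q) and (r m).\<close>
  define m where "m = p + 1"
  have pm: "p = m + 1" unfolding m_def using two by (simp add: add.assoc)
  have "m * m + q * r = 0" using a(1) two unfolding A p' pm by (simp add: char2)
  then have mqr: "m * m = q * r" by (simp add: add_eq_0)
  have nz: "(m, q, r) \<noteq> (0, 0, 0)" using a(3) unfolding A p' pm by auto
  obtain a b c d where X: "x = (a, b, c, d)" by (cases x)
  obtain e f g h where Y: "y = (e, f, g, h)" by (cases y)
  have det: "a * d - b * c = 1" "e * h - f * g = 1" using x y X Y by auto
  have lin: "m * (u + v) + q * w + r * z = 0"
    if "mat2_tr (mat2_mult (p, q, r, p') (u, z, w, v)) = mat2_tr (u, z, w, v)" for u v w z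
  proof -
    have "(m * (u + v) + q * w + r * z) + (u + v) = u + v"
      using that unfolding p' pm by (simp add: char2)
    then show ?thesis by simp
  qed
  have lx: "m * (a + d) + q * c + r * b = 0" and ly: "m * (e + h) + q * g + r * f = 0"
    using x(2) y(2) unfolding X Y A by (intro lin; simp)+
  have "(b * g - c * f) ^ 2 + (a * f + b * h - e * b - f * d) * (c * e + d * g - g * a - h * c) = 0"
  proof (cases "q = 0")
    case True
    then have "m = 0" "r \<noteq> 0" using mqr nz by auto
    then have "b = 0" "f = 0" using lx ly True by auto
    then show ?thesis by simp
  next
    case False
    \<comment> \<open>The vector \<open>(1, k)\<close> spans the line fixed by \<open>a\<close>;
      solving the linear condition for the lower left entry expresses that it is an
      eigenvector.\<close>
    define k where "k = m / q"
    have m: "m = k * q" using False k_def by simp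
    have r: "r = k * k * q" using mqr False unfolding m by (simp add: mult.assoc mult.left_commute)
    have solve: "w = k * (u + v) + k * k * z" if "m * (u + v) + q * w + r * z = 0" for u v w z
    proof -
      have "q * (w + (k * (u + v) + k * k * z)) = 0" using that unfolding m r by (simp add: char2)
      then show ?thesis using False by (simp add: add_eq_0)
    qed
    have c: "c = k * (a + d) + k * k * b" and g: "g = k * (e + h) + k * k * f"
      using solve lx ly by auto
    show ?thesis unfolding c g by (simp add: char2)
  qed
  then show ?thesis
    unfolding mat2_det_Lie[OF det] solv_traces_def X Y by (simp add: diff_self numeral_two add_eq_0 add.assoc)
qed

text \<open>The conjugate \<open>e\<close> has the trace and determinant of \<open>a\<close> and
  commutes with it, which forces e = a or e = a^-1. So \<open>w\<close> centralizes or inverts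
  \<open>a\<close>, and inverting makes both traces vanish.\<close>

lemma commuting_conjugate_cases:
  assumes a: "a \<in> carrier SL2" "mat2_tr a \<noteq> (0::'a)" and w: "w \<in> carrier SL2"
    and comm: "a \<otimes>\<^bsub>SL2\<^esub> (w \<otimes>\<^bsub>SL2\<^esub> a \<otimes>\<^bsub>SL2\<^esub> inv\<^bsub>SL2\<^esub> w) = (w \<otimes>\<^bsub>SL2\<^esub> a \<otimes>\<^bsub>SL2\<^esub> inv\<^bsub>SL2\<^esub> w) \<otimes>\<^bsub>SL2\<^esub> a"
  shows "mat2_mult w a = mat2_mult a w \<or> mat2_tr w = 0 \<and> mat2_tr (mat2_mult w a) = 0"
proof -
  define e where "e = w \<otimes>\<^bsub>SL2\<^esub> a \<otimes>\<^bsub>SL2\<^esub> inv\<^bsub>SL2\<^esub> w"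
  have ec: "e \<in> carrier SL2" unfolding e_def using a(1) w by (intro SL2.m_closed SL2.inv_closed)
  have ew: "mat2_mult e w = mat2_mult w a"
    using SL2.l_inv[OF w] SL2.r_one[OF a(1)] unfolding e_def by (simp add: mat2_mult_assoc)
  have "mat2_tr e = mat2_tr (inv\<^bsub>SL2\<^esub> w \<otimes>\<^bsub>SL2\<^esub> (w \<otimes>\<^bsub>SL2\<^esub> a))"
    unfolding e_def SL2_simps by (rule mat2_tr_commute)
  also have "\<dots> = mat2_tr a"
    using SL2.l_inv[OF w] SL2.l_one[OF a(1)] by (simp add: mat2_mult_assoc[symmetric])
  finally have tr: "mat2_tr e = mat2_tr a" .
  obtain p q r s where A: "a = (p, q, r, s)" by (cases a)
  obtain p' q' r' s' where E: "e = (p', q', r', s')" by (cases e)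
  obtain x y z u where W: "w = (x, y, z, u)" by (cases w)
  have c: "mat2_mult a e = mat2_mult e a" using comm unfolding e_def by simp
  have t: "p + s \<noteq> 0" using a(2) A by simp
  have "p' + s' = p + s" using tr unfolding A E by simp
  moreover have "p' = (p' + s') + s'" by (simp add: add.assoc add_self)
  ultimately have ps: "p' = (p + s) + s'" by simp
  have h: "p * q' + q * s' = p' * q + q' * s" "r * p' + s * r' = r' * p + s' * r"
    using c unfolding A E by auto
  have "(p + s) * q' + (p + s) * q = (p * q' + q * s') + (p' * q + q' * s)"
    "(p + s) * r' + (p + s) * r = (r * p' + s * r') + (r' * p + s' * r)"
    unfolding ps by (simp_all add: char2)
  then have "(p + s) * q' = (p + s) * q" "(p + s) * r' = (p + s) * r"
    unfolding h add_self by (simp_all only: add_eq_0)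
  then have qr: "q' = q" "r' = r" using t by auto
  \<comment> \<open>Equality of the determinants leaves a quadratic equation for \<open>s'\<close>
    with roots \<open>p\<close> and \<open>s\<close>.\<close>
  have "p * s + p' * s' = 0" using a(1) ec unfolding A E qr by (simp add: diff_eq_eq add_self)
  then have "(s' + p) * (s' + s) = 0" unfolding ps by (simp add: char2)
  then consider "s' = p" | "s' = s" by (auto simp: add_eq_0)
  then show ?thesis
  proof cases
    case 1
    \<comment> \<open>Here e = a^-1. Adding the two diagonal entries of ew = wa isolates the trace
      of \<open>w\<close>.\<close>
    then have p: "p' = s" unfolding ps by (simp add: char2)
    have eqs: "s * x + q * z = x * p + y * r" "r * y + p * u = z * q + u * s"
      using ew unfolding A E W qr p 1 by auto
    have "(p + s) * (x + u) = (s * x + q * z + (r * y + p * u)) + (x * p + y * r + (z * q + u * s))"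
      by (simp add: char2)
    then have "(p + s) * (x + u) = 0" unfolding eqs by (simp only: add_self)
    then have "u = x" using t by (simp add: add_eq_0)
    moreover have "mat2_tr (mat2_mult w a) = (x * p + y * r) + (s * u + q * z)"
      unfolding W A by (simp add: ac_simps)
    ultimately show ?thesis using eqs(1) unfolding W by (simp add: add_self)
  next
    case 2
    then have "p' = p" unfolding ps by (simp add: char2)
    then have "e = a" unfolding A E using qr 2 by simp
    then show ?thesis using ew by simp
  qed
qed

text \<open>A matrix of nonzero trace is not scalar in characteristic 2, and the centralizer of a
  nonscalar 2x2 matrix is spanned by 1 and that matrix.\<close>

lemma commuting_combination:
  assumes "mat2_mult w (p, q, r, s) = mat2_mult (p, q, r, s) w" "p + s \<noteq> (0::'a)"
  obtains \<alpha> \<beta> where "w = (\<alpha> + \<beta> * p, \<beta> * q, \<beta> * r, \<alpha> + \<beta> * s)"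
proof -
  obtain x y z u where W: "w = (x, y, z, u)" by (cases w)
  have "x * q + y * s = p * y + q * u" "z * p + u * r = r * x + s * z" using assms W by auto
  then have "(x * q + y * s) + (p * y + q * u) = 0" "(z * p + u * r) + (r * x + s * z) = 0"
    by (simp_all only: add_self)
  then have "y * (p + s) + (x + u) * q = 0" "z * (p + s) + (x + u) * r = 0"
    by (simp_all add: ring_distribs ac_simps)
  then have e: "y * (p + s) = (x + u) * q" "z * (p + s) = (x + u) * r"
    by (simp_all only: add_eq_0)
  \<comment> \<open>Forced by traces, since the trace of the scalar part \<alpha> is 0.\<close>
  define \<beta> where "\<beta> = (x + u) / (p + s)"
  have b: "\<beta> * (p + s) = x + u" using assms(2) unfolding \<beta>_def by simp
  show thesis
  proof (rule that[of "x + \<beta> * p" \<beta>])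
    have "x + \<beta> * p + \<beta> * s = u" using b by (simp add: ring_distribs add.assoc add_self_left)
    moreover have "y = \<beta> * q" "z = \<beta> * r" using e assms(2) unfolding \<beta>_def by (simp_all add: field_simps)
    ultimately show "w = (x + \<beta> * p + \<beta> * p, \<beta> * q, \<beta> * r, x + \<beta> * p + \<beta> * s)"
      unfolding W by (simp add: add.assoc add_self)
  qed
qed

text \<open>If \<open>a\<close> has trace 0, both generators preserve its fixed line. Otherwise each
  centralizes or inverts \<open>a\<close>: if both centralize they commute, if exactly one inverts
  then it and \<open>xy\<close> have trace 0, and if both invert then both have trace 0.\<close>

lemma solvable_imp_solv_traces:
  assumes x: "x \<in> carrier SL2" and y: "y \<in> carrier SL2"
    and solv: "solvable (SL2\<lparr>carrier := generate SL2 {x, y}\<rparr>)"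
  shows "solv_traces (mat2_tr x) (mat2_tr y) (mat2_tr (mat2_mult x y) :: 'a)"
proof (cases "generate SL2 {x, y} = {\<one>\<^bsub>SL2\<^esub>}")
  case True
  then have "x = \<one>\<^bsub>SL2\<^esub>" "y = \<one>\<^bsub>SL2\<^esub>" using generate.incl[of _ "{x, y}" SL2] by blast+
  then show ?thesis using two by (simp add: solv_traces_def)
next
  case False
  have xy: "x \<in> generate SL2 {x, y}" "y \<in> generate SL2 {x, y}" by (auto intro: generate.incl)
  have sub: "subgroup (generate SL2 {x, y}) SL2" using x y by (intro SL2.generate_is_subgroup) auto
  obtain a where aK: "a \<in> generate SL2 {x, y}" and a1: "a \<noteq> \<one>\<^bsub>SL2\<^esub>"
    and comm: "\<And>w. w \<in> generate SL2 {x, y} \<Longrightarrow>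
      a \<otimes>\<^bsub>SL2\<^esub> (w \<otimes>\<^bsub>SL2\<^esub> a \<otimes>\<^bsub>SL2\<^esub> inv\<^bsub>SL2\<^esub> w) = (w \<otimes>\<^bsub>SL2\<^esub> a \<otimes>\<^bsub>SL2\<^esub> inv\<^bsub>SL2\<^esub> w) \<otimes>\<^bsub>SL2\<^esub> a"
    using SL2.solvable_imp_commuting_conjugates[OF sub solv False] by blast
  have a: "a \<in> carrier SL2" using aK subgroup.subset[OF sub] by blast
  show ?thesis
  proof (cases "mat2_tr a = 0")
    case True
    then show ?thesis
      using common_fixed_line_traces[OF a True a1 x _ y] mat2_tr_involution_mult[OF a True] comm x y xy by blast
  next
    case nz: False
    obtain p q r s where A: "a = (p, q, r, s)" by (cases a)
    have t: "p + s \<noteq> 0" using nz A by simp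
    \<comment> \<open>As \<open>w\<close> is a combination of 1 and \<open>a\<close>, tr(vw) is one
      of tr(v) and tr(va), both 0.\<close>
    have mixed: "mat2_tr (mat2_mult v w) = 0"
      if vw: "mat2_mult w a = mat2_mult a w" "mat2_tr v = 0" "mat2_tr (mat2_mult v a) = 0" for v w
    proof -
      obtain \<alpha> \<beta> where w: "w = (\<alpha> + \<beta> * p, \<beta> * q, \<beta> * r, \<alpha> + \<beta> * s)"
        using commuting_combination vw(1) t unfolding A by blast
      obtain b c d e where v: "v = (b, c, d, e)" by (cases v)
      have "mat2_tr (mat2_mult v w) = \<alpha> * mat2_tr v + \<beta> * mat2_tr (mat2_mult v a)"
        unfolding v w A by (simp add: algebra_simps)
      then show ?thesis using vw by simp
    qed
    have "mat2_mult x a = mat2_mult a x \<or> mat2_tr x = 0 \<and> mat2_tr (mat2_mult x a) = 0"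
      "mat2_mult y a = mat2_mult a y \<or> mat2_tr y = 0 \<and> mat2_tr (mat2_mult y a) = 0"
      using commuting_conjugate_cases[OF a nz] x y comm xy by blast+
    then consider "mat2_mult x a = mat2_mult a x" "mat2_mult y a = mat2_mult a y"
      | "mat2_tr x = 0" "mat2_tr (mat2_mult x y) = 0" | "mat2_tr y = 0" "mat2_tr (mat2_mult x y) = 0"
      | "mat2_tr x = 0" "mat2_tr y = 0"
      using mixed mat2_tr_commute by metis
    then show ?thesis
    proof cases
      case 1
      obtain \<alpha> \<beta> \<alpha>' \<beta>' where X: "x = (\<alpha> + \<beta> * p, \<beta> * q, \<beta> * r, \<alpha> + \<beta> * s)"
        and Y: "y = (\<alpha>' + \<beta>' * p, \<beta>' * q, \<beta>' * r, \<alpha>' + \<beta>' * s)"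
        using commuting_combination 1 t unfolding A by metis
      have "x \<otimes>\<^bsub>SL2\<^esub> y = y \<otimes>\<^bsub>SL2\<^esub> x" unfolding X Y by (simp add: algebra_simps)
      then have "x \<otimes>\<^bsub>SL2\<^esub> y \<otimes>\<^bsub>SL2\<^esub> inv\<^bsub>SL2\<^esub> x \<otimes>\<^bsub>SL2\<^esub> inv\<^bsub>SL2\<^esub> y = \<one>\<^bsub>SL2\<^esub>"
        using x y by (metis SL2.inv_solve_right SL2.m_closed SL2.r_inv)
      then show ?thesis using mat2_tr_commutator[OF x y] two
        by (simp add: solv_traces_def numeral_two diff_self add_eq_0)
    qed (auto simp: solv_traces_def)
  qed
qed

section \<open>Counting solvabilizers\<close>

lemma Sol_SL2_iff:
  assumes "x \<in> carrier SL2"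
  shows "y \<in> Sol SL2 x \<longleftrightarrow>
    y \<in> carrier SL2 \<and> solv_traces (mat2_tr x) (mat2_tr y) (mat2_tr (mat2_mult x y) :: 'a)"
  unfolding Sol_def
  using solv_traces_imp_solvable[OF assms] solvable_imp_solv_traces[OF assms] by blast

text \<open>With X = 0 and Y nonzero the criterion says Z = Y or Z = 0. The quotient Z / Y is affine
  in the off-diagonal entries of y / tr(y).\<close>

lemma solv_traces_involution_torus:
  fixes a b c p q r s :: 'a
  assumes "a * a - b * c = 1" and t: "p + s \<noteq> 0"
  shows "solv_traces (a + a) (p + s) (mat2_tr (mat2_mult (a, b, c, a) (p, q, r, s))) \<longleftrightarrow>
    b * (r / (p + s)) + c * (q / (p + s)) + a \<in> {0, 1}"
proof -
  define L where "L = b * (r / (p + s)) + c * (q / (p + s)) + a"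
  have Z: "mat2_tr (mat2_mult (a, b, c, a) (p, q, r, s)) = (p + s) * L"
  proof -
    have "b * r = (p + s) * (b * (r / (p + s)))" "c * q = (p + s) * (c * (q / (p + s)))"
      using t by simp_all
    then have "(p + s) * L = b * r + c * q + (p + s) * a" unfolding L_def by (simp only: distrib_left)
    then show ?thesis by (simp add: algebra_simps)
  qed
  have "(p + s) ^ 2 + ((p + s) * L) ^ 2 = 0 \<longleftrightarrow> L = 1"
    unfolding add_eq_0 square_eq using t by auto
  then show ?thesis
    unfolding Z L_def[symmetric] solv_traces_def using t by (auto simp: add_self)
qed

lemma solv_traces_torus_involution:
  fixes a b c p q r s :: 'a
  assumes "a * a - b * c = 1" and t: "p + s \<noteq> 0"
  shows "solv_traces (p + s) (a + a) (mat2_tr (mat2_mult (p, q, r, s) (a, b, c, a))) \<longleftrightarrow>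
    b * (r / (p + s)) + c * (q / (p + s)) + a \<in> {0, 1}"
  using solv_traces_involution_torus[OF assms]
  by (subst solv_traces_commute, subst mat2_tr_commute)

text \<open>Write x = p + tu, where \<open>u\<close> has rows (0 \<beta>) and (\<gamma> 1) and
  \<open>m\<close> is the trace of uy. Eliminating \<open>p\<close> by the determinant leaves t^2
  times an expression in \<beta>, \<gamma> and y alone, so only the torus of \<open>x\<close>
  matters.\<close>

lemma solv_traces_torus:
  fixes p q r s :: 'a
  assumes x: "p * s - q * r = 1" and t: "p + s \<noteq> 0"
  defines "\<beta> \<equiv> q / (p + s)" and "\<gamma> \<equiv> r / (p + s)"
  shows "solv_traces (p + s) (e + h) (mat2_tr (mat2_mult (p, q, r, s) (e, f, g, h))) \<longleftrightarrow>
    e + h = 0 \<and> \<beta> * g + \<gamma> * f + h = 0 \<or>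
    1 + \<beta> * \<gamma> * (e + h) ^ 2 + (\<beta> * g + \<gamma> * f + h) ^ 2 + (\<beta> * g + \<gamma> * f + h) * (e + h) = 0"
proof -
  define t where "t = p + s"
  define y where "y = e + h"
  define m where "m = \<beta> * g + \<gamma> * f + h"
  have t0: "t \<noteq> 0" using t t_def by simp
  have q: "q = t * \<beta>" and r: "r = t * \<gamma>" unfolding \<beta>_def \<gamma>_def t_def using t by auto
  have s: "s = p + t" unfolding t_def by (simp add: char2)
  have Z: "mat2_tr (mat2_mult (p, q, r, s) (e, f, g, h)) = p * y + t * m"
    unfolding y_def m_def q r s by (simp add: algebra_simps)
  have det: "p * p + p * t + t * t * \<beta> * \<gamma> = 1" using x unfolding q r s by (simp add: char2)
  have "t ^ 2 + y ^ 2 + (p * y + t * m) ^ 2 + t * y * (p * y + t * m) =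
    t ^ 2 + (1 + (p * p + p * t)) * y ^ 2 + t ^ 2 * (m ^ 2 + m * y)" by (simp add: char2)
  also have "1 + (p * p + p * t) = t * t * \<beta> * \<gamma>" unfolding det[symmetric] by (simp add: char2)
  also have "t ^ 2 + t * t * \<beta> * \<gamma> * y ^ 2 + t ^ 2 * (m ^ 2 + m * y) =
    t ^ 2 * (1 + \<beta> * \<gamma> * y ^ 2 + m ^ 2 + m * y)" by (simp add: char2)
  finally have "t ^ 2 + y ^ 2 + (p * y + t * m) ^ 2 = t * y * (p * y + t * m) \<longleftrightarrow>
    1 + \<beta> * \<gamma> * y ^ 2 + m ^ 2 + m * y = 0"
    using t0 by (metis add_eq_0 mult_eq_0_iff power_eq_0_iff)
  then show ?thesis
    unfolding Z t_def[symmetric] y_def[symmetric] m_def[symmetric] solv_traces_def using t0 by auto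
qed

section \<open>Separating and counting solvabilizers over a perfect field with more than two
  elements\<close>

context
  fixes k :: 'a
  assumes k: "k \<noteq> 0" "k \<noteq> 1"
    and perfect: "\<And>x::'a. \<exists>y. y ^ 2 = x"
begin

text \<open>Every pair of off-diagonal parameters is realized: the matrix with rows (\<alpha>
  \<beta>) and (\<gamma> \<alpha>+1) has trace 1, and any such matrix of nonzero determinant can be
  scaled into \<open>SL2\<close>.\<close>

lemma ex_torus_element: "\<exists>p s. p + s \<noteq> 0 \<and> p * s - ((p + s) * \<beta>) * ((p + s) * \<gamma>) = (1::'a)"
proof -
  have "\<exists>\<alpha>. \<alpha> * \<alpha> + \<alpha> + \<beta> * \<gamma> \<noteq> 0"
  proof (cases "\<beta> * \<gamma> = 0")
    case True
    have "k * (k + 1) \<noteq> 0" using k add_eq_0[of k 1] by (metis mult_eq_0_iff)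
    then have "k * k + k + \<beta> * \<gamma> \<noteq> 0" unfolding True by (simp only: distrib_left mult_1_right add_0_right simp_thms)
    then show ?thesis by blast
  next
    case False
    then have "0 * 0 + 0 + \<beta> * \<gamma> \<noteq> 0" by simp
    then show ?thesis by blast
  qed
  then obtain \<alpha> where \<alpha>: "\<alpha> * \<alpha> + \<alpha> + \<beta> * \<gamma> \<noteq> 0" by blast
  \<comment> \<open>The scaling factor is a square root of the inverse determinant.\<close>
  obtain t where t: "t ^ 2 = inverse (\<alpha> * \<alpha> + \<alpha> + \<beta> * \<gamma>)" using perfect by blast
  have t0: "t \<noteq> 0" using t \<alpha> by auto
  have tr: "t * \<alpha> + (t * \<alpha> + t) = t" by (simp add: char2)
  have "t * \<alpha> * (t * \<alpha> + t) - (t * \<beta>) * (t * \<gamma>) = t ^ 2 * (\<alpha> * \<alpha> + \<alpha> + \<beta> * \<gamma>)" by (simp add: char2)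
  also have "\<dots> = 1" using t \<alpha> by simp
  finally show ?thesis using tr t0 by (metis (no_types))
qed

text \<open>Affine functions of different slopes have different preimages of {0, 1}. If one slope is
  0, its condition always holds, while the other function takes the value \<open>k\<close>.\<close>

lemma affine_separation:
  assumes "c \<noteq> c'" "c = 0 \<Longrightarrow> a \<in> {0, 1}" "c' = 0 \<Longrightarrow> a' \<in> {0, 1}"
  shows "\<exists>\<beta>::'a. (c * \<beta> + a \<in> {0, 1}) \<noteq> (c' * \<beta> + a' \<in> {0, 1})"
proof -
  have solve: "d * ((v + b) / d) + b = v" if "d \<noteq> 0" for d v b :: 'a
    using that by (simp add: add.assoc add_self)
  show ?thesis
  proof (cases "c = 0 \<or> c' = 0")
    case True
    then consider "c = 0" "c' \<noteq> 0" | "c \<noteq> 0" "c' = 0" using assms(1) by blast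
    then show ?thesis
    proof cases
      case 1 then show ?thesis using solve[of c' k a'] assms k by (intro exI[of _ "(k + a') / c'"]) auto
    next
      case 2 then show ?thesis using solve[of c k a] assms k by (intro exI[of _ "(k + a) / c"]) auto
    qed
  next
    case False
    \<comment> \<open>At the points where the first function is 0 and 1, the values of the second
      differ by \<open>c' / c\<close>, which is neither 0 nor 1; so they do not both lie in {0,
      1}.\<close>
    define \<beta> where "\<beta> v = (v + a) / c" for v
    have \<beta>: "c * \<beta> 0 + a = 0" "c * \<beta> 1 + a = 1" unfolding \<beta>_def using solve False by auto
    have "c' * \<beta> 1 + a' = (c' * \<beta> 0 + a') + c' / c"
      unfolding \<beta>_def using False by (simp add: field_simps)
    moreover have "c' / c \<noteq> 0" "c' / c \<noteq> 1" using False assms(1) by auto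
    moreover have "\<not> (u \<in> {0, 1} \<and> u + w \<in> {0, 1})" if "w \<noteq> 0" "w \<noteq> 1" for u w :: 'a
      using that add_eq_0[of 1 w] by auto
    ultimately have "\<not> (c' * \<beta> 0 + a' \<in> {0, 1} \<and> c' * \<beta> 1 + a' \<in> {0, 1})"
      by metis
    then show ?thesis using \<beta> by (metis insertCI)
  qed
qed

text \<open>Every torus has a trace 0 element outside its solvabilizer; the witnesses are chosen to
  give the value \<open>k\<close>.\<close>

lemma ex_involution:
  "\<exists>a b c. a * a - b * c = 1 \<and> b * \<gamma> + c * \<beta> + a \<notin> {0, 1::'a}"
proof -
  have k1: "(k + 1) + 1 = k" using two by (simp add: add.assoc)
  consider "\<gamma> \<noteq> 0" | "\<beta> \<noteq> 0" | "\<beta> = 0" "\<gamma> = 0" by blast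
  then show ?thesis
  proof cases
    case 1
    then have "1 * 1 - ((k + 1) / \<gamma>) * 0 = 1 \<and> ((k + 1) / \<gamma>) * \<gamma> + 0 * \<beta> + 1 \<notin> {0, 1}" using k k1 by simp
    then show ?thesis by blast
  next
    case 2
    then have "1 * 1 - 0 * ((k + 1) / \<beta>) = 1 \<and> 0 * \<gamma> + ((k + 1) / \<beta>) * \<beta> + 1 \<notin> {0, 1}" using k k1 by simp
    then show ?thesis by blast
  next
    case 3
    then have "k * k - (k * k - 1) * 1 = 1 \<and> (k * k - 1) * \<gamma> + 1 * \<beta> + k \<notin> {0, 1}" using k by simp
    then show ?thesis by blast
  qed
qed

lemma fingerprint_surj: "fingerprint ` carrier SL2 = (UNIV :: (bool \<times> 'a \<times> 'a) set)"
proof -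
  have "(i, \<beta>, \<gamma>) \<in> fingerprint ` carrier SL2" for i and \<beta> \<gamma> :: 'a
  proof (cases i)
    case True
    obtain a where "a ^ 2 = 1 + \<beta> * \<gamma>" using perfect by blast
    then have "(a, \<beta>, \<gamma>, a) \<in> carrier SL2" by (simp add: power2_eq_square)
    moreover have "fingerprint (a, \<beta>, \<gamma>, a) = (i, \<beta>, \<gamma>)" using True by (simp add: fingerprint_def add_self)
    ultimately show ?thesis by (metis image_eqI)
  next
    case False
    obtain p s where ps: "p + s \<noteq> 0" "p * s - ((p + s) * \<beta>) * ((p + s) * \<gamma>) = 1"
      using ex_torus_element by blast
    then have "(p, (p + s) * \<beta>, (p + s) * \<gamma>, s) \<in> carrier SL2" by simp
    moreover have "fingerprint (p, (p + s) * \<beta>, (p + s) * \<gamma>, s) = (i, \<beta>, \<gamma>)"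
      using False ps(1) by (simp add: fingerprint_def)
    ultimately show ?thesis by (metis image_eqI)
  qed
  then show ?thesis by auto
qed

text \<open>The solvabilizer of a trace 0 element contains all trace 0 elements, that of a torus
  element does not.\<close>

lemma Sol_SL2_involution_neq:
  fixes a b c p q r s :: 'a
  assumes x: "(a, b, c, a) \<in> carrier SL2" and y: "(p, q, r, s) \<in> carrier SL2" "p + s \<noteq> 0"
  shows "Sol SL2 (a, b, c, a) \<noteq> Sol SL2 (p, q, r, s)"
proof -
  obtain d e f where z: "d * d - e * f = 1"
    "e * (r / (p + s)) + f * (q / (p + s)) + d \<notin> {0, 1}" using ex_involution by blast
  have "(d, e, f, d) \<in> Sol SL2 (a, b, c, a)"
    using z(1) unfolding Sol_SL2_iff[OF x] by (simp add: solv_traces_def add_self)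
  moreover have "(d, e, f, d) \<notin> Sol SL2 (p, q, r, s)"
    using solv_traces_torus_involution[OF z(1) y(2), of q r] z(2) unfolding Sol_SL2_iff[OF y(1)]
    by (auto simp del: mat2_mult_simps)
  ultimately show ?thesis by blast
qed

text \<open>Elements of trace 0 are told apart by testing them against tori, and tori by testing
  them against elements of trace 0.\<close>

lemma Sol_SL2_eq_iff:
  assumes x: "x \<in> carrier SL2" and y: "y \<in> carrier SL2"
  shows "Sol SL2 x = Sol SL2 y \<longleftrightarrow> fingerprint x = fingerprint (y :: 'a mat2)"
proof -
  obtain a b c d where X: "x = (a, b, c, d)" by (cases x)
  obtain e f g h where Y: "y = (e, f, g, h)" by (cases y)
  have det: "a * d - b * c = 1" "e * h - f * g = 1" using x y X Y by auto
  consider (inv) "d = a" "h = e" | (left) "d = a" "e + h \<noteq> 0" | (right) "a + d \<noteq> 0" "h = e"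
    | (torus) "a + d \<noteq> 0" "e + h \<noteq> 0" using add_eq_0 by metis
  then show ?thesis
  proof cases
    case inv
    note det = det[unfolded inv]
    \<comment> \<open>Supplies the side conditions of \<open>affine_separation\<close>: where a
      slope vanishes, the constant term is a square root of 1.\<close>
    have one: "u \<in> {0, 1}" if "u * u - v * w = 1" "v = 0 \<or> w = 0" for u v w :: 'a
      using that square_eq[of u 1] by (auto simp: power2_eq_square)
    have mem: "(p, (p + s) * \<beta>, (p + s) * \<gamma>, s) \<in> Sol SL2 (u, v, w, u) \<longleftrightarrow> w * \<beta> + v * \<gamma> + u \<in> {0, 1}"
      if "p + s \<noteq> 0" "p * s - ((p + s) * \<beta>) * ((p + s) * \<gamma>) = 1" "u * u - v * w = 1" for p s u v w \<beta> \<gamma> :: 'a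
      using solv_traces_involution_torus[OF that(3,1), of "(p + s) * \<beta>" "(p + s) * \<gamma>"] that(1,2)
        Sol_SL2_iff[of "(u, v, w, u)"] that(3) by (simp add: add.commute[of "v * \<gamma>"] del: mat2_mult_simps)
    \<comment> \<open>Two elements of trace 0 are separated by a torus with one off-diagonal parameter 0.\<close>
    have "b = f \<and> c = g" if eq: "Sol SL2 x = Sol SL2 y"
    proof (rule ccontr)
      assume "\<not> (b = f \<and> c = g)"
      then obtain \<beta> \<gamma> where "(c * \<beta> + b * \<gamma> + a \<in> {0, 1}) \<noteq> (g * \<beta> + f * \<gamma> + e \<in> {0, 1})"
      proof (cases "c = g")
        case True
        then have "b \<noteq> f" using \<open>\<not> (b = f \<and> c = g)\<close> by simp
        then show ?thesis
          using affine_separation[of b f a e] one[OF det(1)] one[OF det(2)] that[of 0] by auto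
      next
        case False
        then show ?thesis
          using affine_separation[of c g a e] one[OF det(1)] one[OF det(2)] that[of _ 0] by auto
      qed
      moreover obtain p s where "p + s \<noteq> 0" "p * s - ((p + s) * \<beta>) * ((p + s) * \<gamma>) = 1"
        using ex_torus_element by blast
      ultimately show False using mem det eq unfolding X Y inv by blast
    qed
    moreover have "x = y" if "b = f" "c = g"
    proof -
      \<comment> \<open>The off-diagonal entries determine the square of the diagonal entry, hence
        the entry.\<close>
      have "a ^ 2 = e ^ 2" using det that by (simp add: power2_eq_square diff_eq_eq)
      then show ?thesis unfolding X Y inv square_eq using that by simp
    qed
    moreover have "fingerprint x = fingerprint y \<longleftrightarrow> b = f \<and> c = g"
      unfolding X Y inv by (simp add: fingerprint_def add_self)
    ultimately show ?thesis by blast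
  next
    case left
    have "Sol SL2 x \<noteq> Sol SL2 y"
      using Sol_SL2_involution_neq[OF x[unfolded X left(1)] y[unfolded Y] left(2)] unfolding X Y left(1) .
    moreover have "fingerprint x \<noteq> fingerprint y"
      using left(2) unfolding X Y left(1) by (simp add: fingerprint_def add_self)
    ultimately show ?thesis by blast
  next
    case right
    have "Sol SL2 y \<noteq> Sol SL2 x"
      using Sol_SL2_involution_neq[OF y[unfolded Y right(2)] x[unfolded X] right(1)] unfolding X Y right(2) .
    moreover have "fingerprint x \<noteq> fingerprint y"
      using right(1) unfolding X Y right(2) by (simp add: fingerprint_def add_self)
    ultimately show ?thesis by metis
  next
    case torus
    define \<beta> \<gamma> \<beta>' \<gamma>' where bg: "\<beta> = b / (a + d)" "\<gamma> = c / (a + d)" "\<beta>' = f / (e + h)" "\<gamma>' = g / (e + h)"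
    have mem: "(1, v, w, 1) \<in> Sol SL2 (p, q, r, s) \<longleftrightarrow> v * (r / (p + s)) + w * (q / (p + s)) + 1 \<in> {0, 1}"
      if "p + s \<noteq> 0" "p * s - q * r = 1" "v = 0 \<or> w = 0" for p q r s v w :: 'a
    proof -
      have 1: "1 * 1 - v * w = 1" using that(3) by auto
      have "(p, q, r, s) \<in> carrier SL2" "(1, v, w, 1) \<in> carrier SL2" using that(2) 1 by simp_all
      then show ?thesis
        unfolding solv_traces_torus_involution[OF 1 that(1), symmetric]
        using Sol_SL2_iff[of "(p, q, r, s)" "(1, v, w, 1)"] unfolding mat2_tr_simps by blast
    qed
    \<comment> \<open>Two tori are separated by a triangular unipotent element.\<close>
    have "\<beta> = \<beta>' \<and> \<gamma> = \<gamma>'" if eq: "Sol SL2 x = Sol SL2 y"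
    proof (rule ccontr)
      assume n: "\<not> (\<beta> = \<beta>' \<and> \<gamma> = \<gamma>')"
      have "\<exists>v w. (v = 0 \<or> w = 0) \<and>
          (v * \<gamma> + w * \<beta> + 1 \<in> {0, 1}) \<noteq> (v * \<gamma>' + w * \<beta>' + 1 \<in> {0, 1})"
      proof (cases "\<gamma> = \<gamma>'")
        case True
        with n obtain w where "(\<beta> * w + 1 \<in> {0, 1}) \<noteq> (\<beta>' * w + 1 \<in> {0, 1})"
          using affine_separation[of \<beta> \<beta>' 1 1] by blast
        then have "(0 * \<gamma> + w * \<beta> + 1 \<in> {0, 1}) \<noteq> (0 * \<gamma>' + w * \<beta>' + 1 \<in> {0, 1})"
          by (simp only: mult.commute[of w] mult_zero_left add_0_left simp_thms)
        then show ?thesis by blast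
      next
        case False
        then obtain v where "(\<gamma> * v + 1 \<in> {0, 1}) \<noteq> (\<gamma>' * v + 1 \<in> {0, 1})"
          using affine_separation[of \<gamma> \<gamma>' 1 1] by blast
        then have "(v * \<gamma> + 0 * \<beta> + 1 \<in> {0, 1}) \<noteq> (v * \<gamma>' + 0 * \<beta>' + 1 \<in> {0, 1})"
          by (simp only: mult.commute[of v] mult_zero_left add_0_right simp_thms)
        then show ?thesis by blast
      qed
      then show False
        using mem[OF torus(1) det(1)] mem[OF torus(2) det(2)] eq unfolding X Y bg by metis
    qed
    moreover have "Sol SL2 x = Sol SL2 y"
      if "\<beta> = \<beta>'" "\<gamma> = \<gamma>'"
    proof (rule Set.set_eqI)
      fix z :: "'a mat2"
      obtain p q r s where Z: "z = (p, q, r, s)" by (cases z)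
      show "z \<in> Sol SL2 x \<longleftrightarrow> z \<in> Sol SL2 y"
        unfolding Sol_SL2_iff[OF x] Sol_SL2_iff[OF y] unfolding X Y Z mat2_tr_simps
          solv_traces_torus[OF det(1) torus(1)] solv_traces_torus[OF det(2) torus(2)] that[unfolded bg] ..
    qed
    moreover have "fingerprint x = fingerprint y \<longleftrightarrow> \<beta> = \<beta>' \<and> \<gamma> = \<gamma>'"
      using torus unfolding X Y bg by (simp add: fingerprint_def)
    ultimately show ?thesis by blast
  qed
qed

text \<open>The factor 2 comes from the Boolean component of the fingerprint, which separates trace
  0 elements from tori.\<close>

lemma card_Solv_SL2: "card (Solv (SL2 :: 'a mat2 monoid)) = 2 * card (UNIV :: 'a set) ^ 2"
proof -
  have "card (Solv (SL2 :: 'a mat2 monoid)) = card (fingerprint ` carrier (SL2 :: 'a mat2 monoid))"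
    unfolding Solv_eq_image by (rule card_image_eq_if_same_kernel) (rule Sol_SL2_eq_iff)
  also have "\<dots> = 2 * card (UNIV :: 'a set) ^ 2"
    unfolding fingerprint_surj UNIV_Times_UNIV[symmetric] card_cartesian_product
    by (simp add: power2_eq_square)
  finally show ?thesis .
qed

end

section \<open>From SL(2,q) to PSL(2,q)\<close>

lemma SL2_scalars_trivial: "SL2_scalars = {\<one>\<^bsub>SL2 :: 'a mat2 monoid\<^esub>}"
proof -
  have "c * c = 1 \<longleftrightarrow> c = 1" for c :: 'a using square_eq[of c 1] by (simp add: power2_eq_square)
  then show ?thesis unfolding SL2_scalars_def by auto
qed

text \<open>The quotient is by the trivial subgroup, so its elements are singletons and
  \<open>the_elem\<close> is an isomorphism.\<close>

lemma card_Solv_PSL2: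
  "card (Solv (PSL2 :: ('a mat2 set) monoid)) = card (Solv (SL2 :: 'a mat2 monoid))"
proof -
  have "the_elem \<in> iso (PSL2 :: ('a mat2 set) monoid) SL2"
    unfolding PSL2_def SL2_scalars_trivial by (rule SL2.trivial_factor_iso)
  moreover have "group (PSL2 :: ('a mat2 set) monoid)"
    unfolding PSL2_def SL2_scalars_trivial by (rule normal.factorgroup_is_group[OF SL2.one_is_normal])
  ultimately show ?thesis by (metis card_Solv_iso SL2_group)
qed

end

theorem theorem4p1:
  fixes n :: nat
  assumes "n \<ge> 2"
    and "card (UNIV :: ('a::{field, finite}) set) = 2 ^ n"
  shows "card (Solv (PSL2 :: ('a mat2 set) monoid)) = 2 * (2 ^ n) ^ 2"
proof -
  \<comment> \<open>Translation by 1 permutes the field, so q times 1 is 0; as q is a power of 2,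
    the characteristic is 2.\<close>
  have "(\<Sum>x\<in>UNIV. x + 1) = (\<Sum>x\<in>UNIV. x :: 'a)"
    by (rule sum.reindex_bij_witness[of _ "\<lambda>x. x - 1" "\<lambda>x. x + 1"]) auto
  then have "of_nat (2 ^ n) = (0::'a)" by (simp add: sum.distrib assms(2)[symmetric])
  then have two: "(1::'a) + 1 = 0" by simp
  \<comment> \<open>Here \<open>n \<ge> 2\<close> enters: a field with at least four elements
    contains some \<open>k\<close> other than 0 and 1.\<close>
  have "(2::nat) ^ 2 \<le> 2 ^ n" using assms(1) by (rule power_increasing) simp
  then have "card {0, 1::'a} < card (UNIV :: 'a set)" using assms(2) by simp
  then have "{0, 1::'a} \<noteq> UNIV" by force
  then obtain k :: 'a where "k \<noteq> 0" "k \<noteq> 1" by blast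
  moreover have "\<exists>y. y ^ 2 = x" for x :: 'a
  proof -
    \<comment> \<open>Finiteness turns injectivity of the Frobenius map into existence of square
      roots.\<close>
    have "inj (\<lambda>y::'a. y ^ 2)" by (rule injI) (simp add: square_eq[OF two])
    then have "surj (\<lambda>y::'a. y ^ 2)" by (rule finite_UNIV_inj_surj[OF finite_UNIV])
    then show ?thesis by (metis surjD)
  qed
  ultimately show ?thesis using card_Solv_PSL2[OF two] card_Solv_SL2[OF two] assms(2) by simp
qed

end
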